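(* Let $n\ge1$, $\sigma>0$, and let $A\subset\mathbb{R}^n$ be nonempty. Let $Y=(Y_1,\dots,Y_n)$ have independent coordinates $Y_m\sim$ Normal$(a_m,\sigma^2)$ with $a\in A$. Let $r_n(A)<\infty$ be an upper bound, uniform over $a\in A$, on the risk $E[\|\hat a-a\|^2]$ of some estimator $\hat a=\hat a(Y)$, and let $r_n^*(A)<\infty$ be an upper bound, uniform over $a\in A$, on the risk $E[\|\hat a^*-a\|^2]$ of some predictive estimator $\hat a^*$. Then for all $\epsilon>0$ (with $N(\epsilon,A)\ge2$), $$r_n(A)\ge\frac{\epsilon^2}{4}\left(1-\frac{n\,r_n^*(A)/(2\sigma^2)+\log2}{\log N(\epsilon,A)}\right).$$ Equivalently, for $\epsilon^2>4r_n(A)$, $$\log N(\epsilon,A)\le\frac{n\,r_n^*(A)/(2\sigma^2)+\log2}{1-4r_n(A)/\epsilon^2}.$$ In particular, for $\epsilon^2\ge 8r_n(A)$ (and $\epsilon>0$), $$\log N(\epsilon,A)\le n\,r_n^*(A)/\sigma^2+2\log2.$$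
   Context: The norm is the normalized Euclidean one: $\|b-a\|^2=\frac1n\sum_{i=1}^n(b_i-a_i)^2$. An estimator is a measurable function $\hat a$ of $Y$ with values in $\mathbb{R}^n$. It is predictive if for each $m=1,\dots,n$ the coordinate $\hat a^*_m$ depends only on $Y_1,\dots,Y_{m-1}$ (so $\hat a_1^*$ is constant). $N(\epsilon,A)$ is the size of a maximal $\epsilon$-packing of $A$, the largest size of a subset $\tilde A\subset A$ such that the distance $\|\cdot\|$ between distinct members of $\tilde A$ is greater than $\epsilon$. Logarithms are natural. *)

theory Defs
  imports "HOL-Probability.Probability" "HOL-Library.Extended_Nat"
begin

text \<open>
  Vectors in n-dimensional real space are the functions in \<open>{1..n} \<rightarrow>\<^sub>E UNIV\<close> (value
  \<open>undefined\<close> off the index set), i.e. the points of the product space below.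
\<close>

abbreviation Rn :: "nat \<Rightarrow> (nat \<Rightarrow> real) measure" where
  "Rn n \<equiv> Pi\<^sub>M {1..n} (\<lambda>_. borel)"

definition nnorm :: "nat \<Rightarrow> (nat \<Rightarrow> real) \<Rightarrow> real" where
  "nnorm n x = sqrt (1 / real n * (\<Sum>i=1..n. (x i)\<^sup>2))"

definition estimator :: "nat \<Rightarrow> ((nat \<Rightarrow> real) \<Rightarrow> (nat \<Rightarrow> real)) \<Rightarrow> bool" where
  "estimator n f \<longleftrightarrow> f \<in> Rn n \<rightarrow>\<^sub>M Rn n"

definition predictive_estimator :: "nat \<Rightarrow> ((nat \<Rightarrow> real) \<Rightarrow> (nat \<Rightarrow> real)) \<Rightarrow> bool" where
  "predictive_estimator n f \<longleftrightarrow> estimator n f \<and>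
     (\<forall>m\<in>{1..n}. \<forall>y\<in>space (Rn n). \<forall>y'\<in>space (Rn n).
        (\<forall>j\<in>{1..<m}. y j = y' j) \<longrightarrow> f y m = f y' m)"

definition sample :: "nat \<Rightarrow> (nat \<Rightarrow> 'w \<Rightarrow> real) \<Rightarrow> 'w \<Rightarrow> (nat \<Rightarrow> real)" where
  "sample n Y \<omega> = (\<lambda>i\<in>{1..n}. Y i \<omega>)"

text \<open>
  The risk is a nonnegative integral: with the Bochner integral, an estimator whose squared
  loss is not integrable would get risk 0.
\<close>

definition risk ::
  "nat \<Rightarrow> 'w measure \<Rightarrow> (nat \<Rightarrow> 'w \<Rightarrow> real) \<Rightarrow> ((nat \<Rightarrow> real) \<Rightarrow> (nat \<Rightarrow> real)) \<Rightarrow> (nat \<Rightarrow> real) \<Rightarrow> ennreal"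
  where
  "risk n P Y f a = (\<integral>\<^sup>+ \<omega>. ennreal ((nnorm n (\<lambda>i. f (sample n Y \<omega>) i - a i))\<^sup>2) \<partial>P)"

definition is_packing :: "nat \<Rightarrow> real \<Rightarrow> (nat \<Rightarrow> real) set \<Rightarrow> (nat \<Rightarrow> real) set \<Rightarrow> bool" where
  "is_packing n \<epsilon> A B \<longleftrightarrow> B \<subseteq> A \<and>
     (\<forall>a\<in>B. \<forall>b\<in>B. a \<noteq> b \<longrightarrow> nnorm n (\<lambda>i. b i - a i) > \<epsilon>)"

text \<open>
  Subsets of packings are packings, so the supremum over finite packings is the largest size
  if packings have bounded size, and \<open>\<infinity>\<close> otherwise (in particular if there is an infinite one).
\<close>

definition packing_number :: "nat \<Rightarrow> real \<Rightarrow> (nat \<Rightarrow> real) set \<Rightarrow> enat" where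
  "packing_number n \<epsilon> A = Sup {enat (card B) | B. finite B \<and> is_packing n \<epsilon> A B}"

text \<open>Only used for positive arguments; note \<open>ln 0 = 0\<close>.\<close>

fun ln_enat :: "enat \<Rightarrow> ereal" where
  "ln_enat (enat k) = ereal (ln (real k))"
| "ln_enat \<infinity> = \<infinity>"

end

theory Submission
  imports Defs
begin

text \<open>
  The predictive estimator \<open>f\<close> gives a probability measure \<open>Q\<close> on sample space under which
  \<open>y m\<close> is, given the past, normal with mean \<open>f y m\<close> and variance \<open>\<sigma>\<^sup>2\<close>; its relative entropy from
  the law of the sample under \<open>a\<close> is \<open>n / (2 * \<sigma>\<^sup>2)\<close> times the risk of \<open>f\<close> at \<open>a\<close>. Given an
  \<open>\<epsilon>\<close>-packing \<open>B\<close> of size \<open>k\<close>, the events that the other estimator is within \<open>\<epsilon> / 2\<close> of \<open>a\<close>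
  are disjoint for distinct \<open>a \<in> B\<close>, so one of them has \<open>Q\<close>-probability at most \<open>1 / k\<close>, while its probability
  under \<open>a\<close> is at least \<open>1 - 4 * r / \<epsilon>\<^sup>2\<close> by Markov's inequality. Comparing the two
  probabilities through the relative entropy bounds \<open>ln k\<close>.
\<close>

section \<open>Product Gaussian laws and the law of the sample\<close>

abbreviation gauss :: "real \<Rightarrow> (nat \<Rightarrow> real) \<Rightarrow> nat \<Rightarrow> real measure" where
  "gauss \<sigma> a m \<equiv> density lborel (\<lambda>x. ennreal (normal_density (a m) \<sigma> x))"

abbreviation gauss_vec :: "nat \<Rightarrow> real \<Rightarrow> (nat \<Rightarrow> real) \<Rightarrow> (nat \<Rightarrow> real) measure" where
  "gauss_vec n \<sigma> a \<equiv> Pi\<^sub>M {1..n} (gauss \<sigma> a)"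

abbreviation lborel_vec :: "nat \<Rightarrow> (nat \<Rightarrow> real) measure" where
  "lborel_vec n \<equiv> Pi\<^sub>M {1..n} (\<lambda>_. lborel)"

lemma sets_gauss_vec [measurable_cong]: "sets (gauss_vec n \<sigma> a) = sets (Rn n)"
  by (intro sets_PiM_cong) simp_all

lemma sets_lborel_vec [measurable_cong]: "sets (lborel_vec n) = sets (Rn n)"
  by (intro sets_PiM_cong) simp_all

text \<open>Independence makes the joint law the product of the marginals, so all later estimates
  can be made on coordinate space, with no reference to \<open>M\<close>.\<close>

lemma distr_sample:
  assumes "prob_space M" "n \<ge> 1"
    and indep: "prob_space.indep_vars M (\<lambda>_. borel) Y {1..n}"
    and Y: "\<And>m. m \<in> {1..n} \<Longrightarrow> distributed M lborel (Y m) (\<lambda>x. ennreal (normal_density (a m) \<sigma> x))"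
  shows "distr M (Rn n) (sample n Y) = gauss_vec n \<sigma> a"
proof -
  interpret prob_space M by fact
  have rv: "random_variable borel (Y m)" if "m \<in> {1..n}" for m
    using distributed_measurable[OF Y[OF that]] by simp
  have "distr M (Rn n) (\<lambda>x. \<lambda>i\<in>{1..n}. Y i x) = Pi\<^sub>M {1..n} (\<lambda>i. distr M borel (Y i))"
    using indep_vars_iff_distr_eq_PiM'[where I = "{1..n}" and M' = "\<lambda>_. borel" and X = Y] rv indep \<open>n \<ge> 1\<close> by auto
  also have "\<dots> = gauss_vec n \<sigma> a"
  proof (rule PiM_cong[OF refl])
    fix m assume "m \<in> {1..n}"
    \<comment> \<open>Independence is stated with target \<open>borel\<close> and the density with
      target \<open>lborel\<close>; a push-forward sees only the sigma-algebra of its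
      target.\<close>
    have "distr M borel (Y m) = distr M lborel (Y m)"
      by (rule distr_cong) auto
    then show "distr M borel (Y m) = gauss \<sigma> a m"
      using distributed_distr_eq_density[OF Y[OF \<open>m \<in> {1..n}\<close>]] by simp
  qed
  finally show ?thesis by (simp add: sample_def[abs_def])
qed

lemma sample_measurable:
  assumes "\<And>m. m \<in> {1..n} \<Longrightarrow> Y m \<in> borel_measurable M"
  shows "sample n Y \<in> M \<rightarrow>\<^sub>M Rn n"
  unfolding sample_def[abs_def] using assms by (rule measurable_restrict)

lemma product_prob_space_gauss: "\<sigma> > 0 \<Longrightarrow> product_prob_space (gauss \<sigma> a)"
  by (intro product_prob_spaceI prob_space_normal_density)

lemma prob_space_gauss_vec: "\<sigma> > 0 \<Longrightarrow> prob_space (gauss_vec n \<sigma> a)"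
  by (intro prob_space_PiM prob_space_normal_density)

text \<open>A product measure is determined by its values on boxes. There the indicator factorizes,
  and Tonelli splits the integral into one-dimensional ones.\<close>

lemma PiM_density:
  fixes D :: "'i \<Rightarrow> 'a \<Rightarrow> ennreal"
  assumes "finite I" "product_sigma_finite M" "product_sigma_finite (\<lambda>i. density (M i) (D i))"
    and D: "\<And>i. i \<in> I \<Longrightarrow> D i \<in> borel_measurable (M i)"
  shows "Pi\<^sub>M I (\<lambda>i. density (M i) (D i)) = density (Pi\<^sub>M I M) (\<lambda>x. \<Prod>i\<in>I. D i (x i))"
proof -
  interpret M: product_sigma_finite M by fact
  interpret N: product_sigma_finite "\<lambda>i. density (M i) (D i)" by fact
  have mD: "(\<lambda>x. D i (x i)) \<in> borel_measurable (Pi\<^sub>M I M)" if "i \<in> I" for i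
    by (rule measurable_compose[OF measurable_component_singleton[OF that, where M = M] D[OF that]])
  have sets: "sets (Pi\<^sub>M I (\<lambda>i. density (M i) (D i))) = sets (Pi\<^sub>M I M)"
    by (intro sets_PiM_cong) simp_all
  show ?thesis
  proof (rule N.PiM_eqI[symmetric])
    show "finite I" by fact
    show "sets (density (Pi\<^sub>M I M) (\<lambda>x. \<Prod>i\<in>I. D i (x i))) = sets (Pi\<^sub>M I (\<lambda>i. density (M i) (D i)))"
      using sets by simp
    fix A assume A: "\<And>i. i \<in> I \<Longrightarrow> A i \<in> sets (density (M i) (D i))"
    then have A': "i \<in> I \<Longrightarrow> A i \<in> sets (M i)" for i by simp
    have AE: "Pi\<^sub>E I A \<in> sets (Pi\<^sub>M I M)"
      using A' \<open>finite I\<close> by (intro sets_PiM_I_finite) auto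
    have "emeasure (density (Pi\<^sub>M I M) (\<lambda>x. \<Prod>i\<in>I. D i (x i))) (Pi\<^sub>E I A)
        = (\<integral>\<^sup>+x. (\<Prod>i\<in>I. D i (x i)) * indicator (Pi\<^sub>E I A) x \<partial>Pi\<^sub>M I M)"
      using AE mD by (intro emeasure_density borel_measurable_prod_ennreal) auto
    also have "\<dots> = (\<integral>\<^sup>+x. (\<Prod>i\<in>I. D i (x i) * indicator (A i) (x i)) \<partial>Pi\<^sub>M I M)"
    proof (rule nn_integral_cong)
      fix x assume x: "x \<in> space (Pi\<^sub>M I M)"
      have "indicator (Pi\<^sub>E I A) x = (\<Prod>i\<in>I. indicator (A i) (x i) :: ennreal)"
      proof (cases "x \<in> Pi\<^sub>E I A")
        case True
        then have "(\<Prod>i\<in>I. indicator (A i) (x i) :: ennreal) = 1"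
          by (intro prod.neutral) (auto simp: PiE_iff)
        then show ?thesis using True by simp
      next
        case False
        then obtain i where "i \<in> I" "x i \<notin> A i"
          using x by (auto simp: space_PiM PiE_iff)
        then have "(\<Prod>i\<in>I. indicator (A i) (x i) :: ennreal) = 0"
          using \<open>finite I\<close> by (intro prod_zero bexI[of _ i]) auto
        then show ?thesis using False by simp
      qed
      then show "(\<Prod>i\<in>I. D i (x i)) * indicator (Pi\<^sub>E I A) x = (\<Prod>i\<in>I. D i (x i) * indicator (A i) (x i))"
        by (simp add: prod.distrib)
    qed
    also have "\<dots> = (\<Prod>i\<in>I. \<integral>\<^sup>+x. D i x * indicator (A i) x \<partial>M i)"
      using D A' by (intro M.product_nn_integral_prod \<open>finite I\<close> borel_measurable_times_ennreal borel_measurable_indicator) auto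
    also have "\<dots> = (\<Prod>i\<in>I. emeasure (density (M i) (D i)) (A i))"
      using D A' by (intro prod.cong) (simp_all add: emeasure_density)
    finally show "emeasure (density (Pi\<^sub>M I M) (\<lambda>x. \<Prod>i\<in>I. D i (x i))) (Pi\<^sub>E I A)
        = (\<Prod>i\<in>I. emeasure (density (M i) (D i)) (A i))" .
  qed
qed

lemma gauss_vec_density:
  assumes "\<sigma> > 0"
  shows "gauss_vec n \<sigma> a
    = density (lborel_vec n) (\<lambda>y. \<Prod>m\<in>{1..n}. ennreal (normal_density (a m) \<sigma> (y m)))"
proof (rule PiM_density)
  show "product_sigma_finite (gauss \<sigma> a)"
    using product_prob_space_gauss[OF assms] by (simp add: product_prob_space_def)
  show "product_sigma_finite (\<lambda>_::nat. lborel :: real measure)" by standard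
qed auto

section \<open>Predictive estimators: joint density and cross moments\<close>

lemma estimator_coord_measurable:
  assumes "estimator n f" "m \<in> {1..n}"
  shows "(\<lambda>y. f y m) \<in> borel_measurable (Rn n)"
  using measurable_compose[OF _ measurable_component_singleton[OF assms(2)]] assms(1)
  unfolding estimator_def by blast

text \<open>The coordinates before \<open>m\<close> survive an update at \<open>j \<ge> m\<close>.
  The case \<open>m = j\<close> is the crucial one: a prediction stays constant while its own
  coordinate is integrated out.\<close>

lemma predictive_upd:
  assumes "predictive_estimator n f" "x \<in> space (Pi\<^sub>M ({1..n} - {j}) (\<lambda>_. borel))"
    and "j \<in> {1..n}" "m \<in> {1..n}" "m \<le> j"
  shows "f (x(j := y)) m = f (x(j := y')) m"
proof -
  have "x(j := z) \<in> space (Rn n)" for z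
    using assms(2,3) by (auto simp: space_PiM PiE_iff extensional_def)
  moreover have "\<forall>i\<in>{1..<m}. (x(j := y)) i = (x(j := y')) i" using \<open>m \<le> j\<close> by auto
  ultimately show ?thesis
    using assms(1,4) unfolding predictive_estimator_def by blast
qed

lemma nn_integral_normal_density: "\<sigma> > 0 \<Longrightarrow> (\<integral>\<^sup>+x. ennreal (normal_density \<mu> \<sigma> x) \<partial>lborel) = 1"
  by (simp add: nn_integral_eq_integral)

text \<open>Interpolate between a product of fixed densities and the predictive product; the conditional
  means are switched on one coordinate at a time, so that at step \<open>j\<close> the remaining factors do
  not involve the \<open>j\<close>-th coordinate.\<close>

lemma nn_integral_predictive_density:
  assumes "\<sigma> > 0" and f: "predictive_estimator n f"
  shows "(\<integral>\<^sup>+y. (\<Prod>m\<in>{1..n}. ennreal (normal_density (f y m) \<sigma> (y m))) \<partial>lborel_vec n) = 1"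
proof -
  interpret L: product_sigma_finite "\<lambda>_::nat. lborel :: real measure" by standard
  \<comment> \<open>At \<open>k = 0\<close> all means are the constant 0 and the integral
    factorizes; at \<open>k = n\<close> they are all those of \<open>f\<close>.\<close>
  define h where "h k y m = (if m \<le> k then f y m else 0)" for k :: nat and y m
  define p where "p k y = (\<Prod>m\<in>{1..n}. ennreal (normal_density (h k y m) \<sigma> (y m)))" for k y
  have fm: "(\<lambda>y. f y m) \<in> borel_measurable (lborel_vec n)" if "m \<in> {1..n}" for m
    using estimator_coord_measurable[OF _ that] f
    by (simp add: predictive_estimator_def measurable_cong_sets[OF sets_lborel_vec refl])
  have hm: "(\<lambda>y. h k y m) \<in> borel_measurable (lborel_vec n)" if "m \<in> {1..n}" for m k
    using fm[OF that] by (cases "m \<le> k") (auto simp: h_def)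
  have pm: "p k \<in> borel_measurable (lborel_vec n)" for k
    unfolding p_def
  proof (rule borel_measurable_prod_ennreal)
    fix m assume m: "m \<in> {1..n}"
    note hm[OF m, measurable]
    have [measurable]: "(\<lambda>y. y m) \<in> borel_measurable (lborel_vec n)" using m by measurable
    show "(\<lambda>y. ennreal (normal_density (h k y m) \<sigma> (y m))) \<in> borel_measurable (lborel_vec n)"
      unfolding normal_density_def by measurable
  qed
  have "(\<integral>\<^sup>+y. p k y \<partial>lborel_vec n) = 1" if "k \<le> n" for k
    using that
  proof (induction k)
    case 0
    have "(\<integral>\<^sup>+y. p 0 y \<partial>lborel_vec n) = (\<integral>\<^sup>+y. (\<Prod>m\<in>{1..n}. ennreal (normal_density 0 \<sigma> (y m))) \<partial>lborel_vec n)"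
      by (simp add: p_def h_def)
    also have "\<dots> = (\<Prod>m\<in>{1..n}. \<integral>\<^sup>+x. ennreal (normal_density 0 \<sigma> x) \<partial>lborel)"
      by (rule L.product_nn_integral_prod) auto
    finally show ?case using \<open>\<sigma> > 0\<close> by (simp add: nn_integral_normal_density)
  next
    case (Suc k)
    define j J where "j = Suc k" and "J = {1..n} - {j}"
    have jJ: "{1..n} = insert j J" "finite J" "j \<notin> J" "j \<in> {1..n}"
      using Suc.prems by (auto simp: j_def J_def)
    \<comment> \<open>Going from \<open>k\<close> to \<open>j\<close> changes only the mean of the
      \<open>j\<close>-th factor, and that factor has integral 1 in either case. The others agree:
      before \<open>j\<close> the means ignore coordinate \<open>j\<close>, so it may be set to 0,
      and after \<open>j\<close> they are 0.\<close>
    have slice: "(\<integral>\<^sup>+y. p l (x(j := y)) \<partial>lborel) = (\<Prod>m\<in>J. ennreal (normal_density (h k (x(j := 0)) m) \<sigma> (x m)))"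
      if x: "x \<in> space (Pi\<^sub>M J (\<lambda>_. lborel))" and l: "l = k \<or> l = j" for x l
    proof -
      have x': "x \<in> space (Pi\<^sub>M ({1..n} - {j}) (\<lambda>_. borel))"
        using x by (simp add: J_def space_PiM)
      have upd: "f (x(j := y)) m = f (x(j := 0)) m" if "m \<in> {1..n}" "m \<le> j" for m y
        using predictive_upd[OF f x' jJ(4) that] .
      have h: "h l (x(j := y)) m = h k (x(j := 0)) m" if "m \<in> J" for m y
        using l that upd[of m y] by (auto simp: h_def j_def J_def)
      have hj: "h l (x(j := y)) j = h l (x(j := 0)) j" for y
        using upd[of j y] jJ(4) by (auto simp: h_def)
      have "p l (x(j := y)) = ennreal (normal_density (h l (x(j := 0)) j) \<sigma> y) *
          (\<Prod>m\<in>J. ennreal (normal_density (h k (x(j := 0)) m) \<sigma> (x m)))" for y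
      proof -
        have "(\<Prod>m\<in>J. ennreal (normal_density (h l (x(j := y)) m) \<sigma> ((x(j := y)) m)))
          = (\<Prod>m\<in>J. ennreal (normal_density (h k (x(j := 0)) m) \<sigma> (x m)))"
          using jJ(3) by (intro prod.cong refl) (auto simp: h)
        then show ?thesis
          unfolding p_def jJ(1) using jJ(2,3) hj[of y] by simp
      qed
      then show ?thesis
        using \<open>\<sigma> > 0\<close> by (simp add: nn_integral_multc nn_integral_normal_density)
    qed
    have ins: "(\<integral>\<^sup>+y. p l y \<partial>lborel_vec n) = (\<integral>\<^sup>+x. (\<integral>\<^sup>+y. p l (x(j := y)) \<partial>lborel) \<partial>Pi\<^sub>M J (\<lambda>_. lborel))" for l
      using pm[of l] unfolding jJ(1) by (rule L.product_nn_integral_insert[OF jJ(2,3)])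
    have "(\<integral>\<^sup>+y. p j y \<partial>lborel_vec n) = (\<integral>\<^sup>+y. p k y \<partial>lborel_vec n)"
      unfolding ins by (rule nn_integral_cong) (simp add: slice)
    then show ?case using Suc by (simp add: j_def)
  qed
  from this[of n] show ?thesis by (simp add: p_def h_def)
qed

text \<open>The prediction error \<open>f y m - a m\<close> does not vary with coordinate
  \<open>m\<close>, so integrating that coordinate out first leaves a constant times the mean of
  centred noise. Fubini is justified by the two finite second moments.\<close>

lemma gauss_vec_cross_moment:
  assumes "\<sigma> > 0" and f: "predictive_estimator n f" and m: "m \<in> {1..n}"
    and int: "integrable (gauss_vec n \<sigma> a) (\<lambda>y. (f y m - a m)\<^sup>2)"
  shows "integrable (gauss_vec n \<sigma> a) (\<lambda>y. (y m - a m) * (f y m - a m))"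
    and "(\<integral>y. (y m - a m) * (f y m - a m) \<partial>gauss_vec n \<sigma> a) = 0"
proof -
  interpret G: product_prob_space "gauss \<sigma> a" "{1..n}" by (rule product_prob_space_gauss) fact
  have [measurable]: "(\<lambda>y. f y m) \<in> borel_measurable (Rn n)"
    using estimator_coord_measurable[OF _ m] f by (simp add: predictive_estimator_def)
  have [measurable]: "(\<lambda>y. y m) \<in> borel_measurable (Rn n)" using m by measurable
  have nm: "integrable (gauss \<sigma> a m) (\<lambda>x. (x - a m) ^ k)" for k
    using integrable_normal_moment[OF \<open>\<sigma> > 0\<close>, of "a m" k]
    by (subst integrable_density) (auto simp: \<open>\<sigma> > 0\<close>)
  have "integrable (distr (gauss_vec n \<sigma> a) (gauss \<sigma> a m) (\<lambda>y. y m)) (\<lambda>x. (x - a m)\<^sup>2)"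
    using G.PiM_component[OF m] nm[of 2] by simp
  then have int2: "integrable (gauss_vec n \<sigma> a) (\<lambda>y. (y m - a m)\<^sup>2)"
    using integrable_distr_eq[OF measurable_component_singleton[OF m], of "\<lambda>x. (x - a m)\<^sup>2" "gauss \<sigma> a"]
    by simp
  show I: "integrable (gauss_vec n \<sigma> a) (\<lambda>y. (y m - a m) * (f y m - a m))"
  proof (rule Bochner_Integration.integrable_bound[OF Bochner_Integration.integrable_add[OF int int2]])
    have "\<bar>u * v\<bar> \<le> \<bar>v\<^sup>2 + u\<^sup>2\<bar>" for u v :: real
    proof -
      have "2 * \<bar>u\<bar> * \<bar>v\<bar> \<le> \<bar>u\<bar>\<^sup>2 + \<bar>v\<bar>\<^sup>2" by (rule sum_squares_bound)
      moreover have "0 \<le> \<bar>u\<bar> * \<bar>v\<bar>" by simp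
      ultimately show ?thesis unfolding abs_mult power2_abs by linarith
    qed
    then show "AE y in gauss_vec n \<sigma> a. norm ((y m - a m) * (f y m - a m)) \<le> norm ((f y m - a m)\<^sup>2 + (y m - a m)\<^sup>2)"
      by simp
  qed measurable
  \<comment> \<open>The odd central moments have exponents \<open>2 * k + 1\<close>; the index 0
    gives the first one.\<close>
  have mean: "(\<integral>x. x - a m \<partial>gauss \<sigma> a m) = 0"
    using integral_normal_moment_odd[OF \<open>\<sigma> > 0\<close>, of "a m" 0]
    by (subst integral_density) (auto simp: \<open>\<sigma> > 0\<close>)
  define J where "J = {1..n} - {m}"
  have mJ: "{1..n} = insert m J" "finite J" "m \<notin> J" using m by (auto simp: J_def)
  have "(\<integral>y. (y m - a m) * (f y m - a m) \<partial>gauss_vec n \<sigma> a)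
      = (\<integral>x. (\<integral>t. (t - a m) * (f (x(m := t)) m - a m) \<partial>gauss \<sigma> a m) \<partial>Pi\<^sub>M J (gauss \<sigma> a))"
    using G.product_integral_insert[OF mJ(2,3) I[unfolded mJ(1)]] unfolding mJ(1) by simp
  also have "\<dots> = (\<integral>x. 0 \<partial>Pi\<^sub>M J (gauss \<sigma> a))"
  proof (rule Bochner_Integration.integral_cong[OF refl])
    fix x assume "x \<in> space (Pi\<^sub>M J (gauss \<sigma> a))"
    then have x: "x \<in> space (Pi\<^sub>M ({1..n} - {m}) (\<lambda>_. borel))" by (simp add: J_def space_PiM)
    define c where "c = f (x(m := 0)) m"
    have "f (x(m := t)) m = c" for t
      unfolding c_def using f x m m by (rule predictive_upd) simp
    then have "(\<integral>t. (t - a m) * (f (x(m := t)) m - a m) \<partial>gauss \<sigma> a m)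
        = (\<integral>t. (t - a m) * (c - a m) \<partial>gauss \<sigma> a m)" by simp
    also have "\<dots> = 0" using mean by simp
    finally show "(\<integral>t. (t - a m) * (f (x(m := t)) m - a m) \<partial>gauss \<sigma> a m) = 0" .
  qed
  finally show "(\<integral>y. (y m - a m) * (f y m - a m) \<partial>gauss_vec n \<sigma> a) = 0" by simp
qed


section \<open>The predictive measure, its likelihood ratio and relative entropy\<close>

definition predictive_measure ::
  "nat \<Rightarrow> real \<Rightarrow> ((nat \<Rightarrow> real) \<Rightarrow> (nat \<Rightarrow> real)) \<Rightarrow> (nat \<Rightarrow> real) measure" where
  "predictive_measure n \<sigma> f
    = density (lborel_vec n) (\<lambda>y. \<Prod>m\<in>{1..n}. ennreal (normal_density (f y m) \<sigma> (y m)))"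

text \<open>This is the logarithm of the density of \<open>predictive_measure n \<sigma> f\<close>
  relative to \<open>gauss_vec n \<sigma> a\<close>: the sum of \<open>((y m - a m)\<^sup>2 - (y m -
  f y m)\<^sup>2) / (2 * \<sigma>\<^sup>2)\<close>, expanded about \<open>a m\<close> to isolate the
  cross term.\<close>

definition log_ratio ::
  "nat \<Rightarrow> real \<Rightarrow> ((nat \<Rightarrow> real) \<Rightarrow> (nat \<Rightarrow> real)) \<Rightarrow> (nat \<Rightarrow> real) \<Rightarrow> (nat \<Rightarrow> real) \<Rightarrow> real" where
  "log_ratio n \<sigma> f a y
    = (\<Sum>m\<in>{1..n}. (2 * ((y m - a m) * (f y m - a m)) - (f y m - a m)\<^sup>2) / (2 * \<sigma>\<^sup>2))"

lemma coord_measurable_Rn: "m \<in> {1..n} \<Longrightarrow> (\<lambda>y. y m) \<in> borel_measurable (Rn n)"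
  by (rule measurable_component_singleton)

lemma log_ratio_measurable:
  assumes "estimator n f"
  shows "log_ratio n \<sigma> f a \<in> borel_measurable (Rn n)"
  unfolding log_ratio_def[abs_def]
proof (rule borel_measurable_sum)
  fix m assume m: "m \<in> {1..n}"
  note coord_measurable_Rn[OF m, measurable] estimator_coord_measurable[OF assms m, measurable]
  show "(\<lambda>y. (2 * ((y m - a m) * (f y m - a m)) - (f y m - a m)\<^sup>2) / (2 * \<sigma>\<^sup>2)) \<in> borel_measurable (Rn n)"
    by measurable
qed

lemma normal_density_product_measurable:
  assumes "\<And>m. m \<in> {1..n} \<Longrightarrow> (\<lambda>y. g y m) \<in> borel_measurable (Rn n)"
  shows "(\<lambda>y. \<Prod>m\<in>{1..n}. ennreal (normal_density (g y m) \<sigma> (y m))) \<in> borel_measurable (Rn n)"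
proof (rule borel_measurable_prod_ennreal)
  fix m assume m: "m \<in> {1..n}"
  note coord_measurable_Rn[OF m, measurable] assms[OF m, measurable]
  show "(\<lambda>y. ennreal (normal_density (g y m) \<sigma> (y m))) \<in> borel_measurable (Rn n)"
    unfolding normal_density_def by measurable
qed

text \<open>Expand the square of \<open>x - \<mu>' = (x - \<mu>) - (\<mu>' - \<mu>)\<close>; the
  common variance makes the normalizing factors equal.\<close>

lemma normal_density_shift:
  assumes "\<sigma> > 0"
  shows "normal_density \<mu>' \<sigma> x
    = normal_density \<mu> \<sigma> x * exp ((2 * ((x - \<mu>) * (\<mu>' - \<mu>)) - (\<mu>' - \<mu>)\<^sup>2) / (2 * \<sigma>\<^sup>2))"
proof -
  have "- (x - \<mu>')\<^sup>2 / (2 * \<sigma>\<^sup>2) = - (x - \<mu>)\<^sup>2 / (2 * \<sigma>\<^sup>2)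
      + (2 * ((x - \<mu>) * (\<mu>' - \<mu>)) - (\<mu>' - \<mu>)\<^sup>2) / (2 * \<sigma>\<^sup>2)"
    unfolding add_divide_distrib[symmetric] by (simp add: power2_eq_square algebra_simps)
  then show ?thesis
    unfolding normal_density_def by (simp only: exp_add mult.assoc)
qed

lemma sets_predictive_measure [measurable_cong]: "sets (predictive_measure n \<sigma> f) = sets (Rn n)"
  unfolding predictive_measure_def using sets_lborel_vec by simp

lemma prob_space_predictive_measure:
  assumes "\<sigma> > 0" "predictive_estimator n f"
  shows "prob_space (predictive_measure n \<sigma> f)"
proof
  have "estimator n f" using assms(2) by (simp add: predictive_estimator_def)
  then have "(\<lambda>y. \<Prod>m\<in>{1..n}. ennreal (normal_density (f y m) \<sigma> (y m))) \<in> borel_measurable (lborel_vec n)"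
    unfolding measurable_cong_sets[OF sets_lborel_vec refl]
    by (intro normal_density_product_measurable estimator_coord_measurable)
  then have "emeasure (predictive_measure n \<sigma> f) (space (predictive_measure n \<sigma> f))
    = (\<integral>\<^sup>+y. (\<Prod>m\<in>{1..n}. ennreal (normal_density (f y m) \<sigma> (y m))) * indicator (space (lborel_vec n)) y \<partial>lborel_vec n)"
    unfolding predictive_measure_def by (simp only: space_density emeasure_density sets.top)
  also have "\<dots> = (\<integral>\<^sup>+y. (\<Prod>m\<in>{1..n}. ennreal (normal_density (f y m) \<sigma> (y m))) \<partial>lborel_vec n)"
    by (intro nn_integral_cong) (simp only: indicator_simps mult_1_right)
  also have "\<dots> = 1" by (rule nn_integral_predictive_density[OF assms])
  finally show "emeasure (predictive_measure n \<sigma> f) (space (predictive_measure n \<sigma> f)) = 1" .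
qed

text \<open>Change of measure: both laws have densities against \<open>lborel_vec n\<close>, and
  \<open>normal_density_shift\<close>, used coordinatewise, shows that their quotient is
  \<open>exp (log_ratio n \<sigma> f a y)\<close>.\<close>

lemma nn_integral_log_ratio:
  assumes "\<sigma> > 0" and f: "estimator n f" and h: "h \<in> borel_measurable (Rn n)"
  shows "(\<integral>\<^sup>+y. ennreal (exp (log_ratio n \<sigma> f a y)) * h y \<partial>gauss_vec n \<sigma> a)
    = (\<integral>\<^sup>+y. h y \<partial>predictive_measure n \<sigma> f)"
proof -
  let ?p = "\<lambda>y. \<Prod>m\<in>{1..n}. ennreal (normal_density (a m) \<sigma> (y m))"
  let ?q = "\<lambda>y. \<Prod>m\<in>{1..n}. ennreal (normal_density (f y m) \<sigma> (y m))"
  note cong = measurable_cong_sets[OF sets_lborel_vec refl]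
  have p: "?p \<in> borel_measurable (lborel_vec n)"
    unfolding cong by (intro normal_density_product_measurable measurable_const) simp
  have q: "?q \<in> borel_measurable (lborel_vec n)"
    unfolding cong by (intro normal_density_product_measurable estimator_coord_measurable f)
  note log_ratio_measurable[OF f, measurable] h[measurable]
  have hL: "(\<lambda>y. ennreal (exp (log_ratio n \<sigma> f a y)) * h y) \<in> borel_measurable (lborel_vec n)"
    by measurable
  have ratio: "?p y * ennreal (exp (log_ratio n \<sigma> f a y)) = ?q y" for y
    unfolding log_ratio_def exp_sum[OF finite_atLeastAtMost]
    by (subst prod_ennreal[symmetric])
       (auto simp: prod.distrib[symmetric] ennreal_mult'[symmetric] normal_density_shift[OF \<open>\<sigma> > 0\<close>, symmetric]
         intro!: prod.cong)
  have "(\<integral>\<^sup>+y. ennreal (exp (log_ratio n \<sigma> f a y)) * h y \<partial>gauss_vec n \<sigma> a)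
      = (\<integral>\<^sup>+y. ?p y * (ennreal (exp (log_ratio n \<sigma> f a y)) * h y) \<partial>lborel_vec n)"
    unfolding gauss_vec_density[OF \<open>\<sigma> > 0\<close>] by (rule nn_integral_density[OF p hL])
  also have "\<dots> = (\<integral>\<^sup>+y. ?q y * h y \<partial>lborel_vec n)"
    unfolding mult.assoc[symmetric] ratio ..
  also have "\<dots> = (\<integral>\<^sup>+y. h y \<partial>predictive_measure n \<sigma> f)"
    unfolding predictive_measure_def
    by (rule nn_integral_density[OF q, symmetric]) measurable
  finally show ?thesis .
qed

text \<open>Orthogonality of noise and prediction error kills the cross terms, and only the squared
  errors survive. Minus the mean is the relative entropy of the true law with respect to the
  predictive one; this is how the risk of \<open>f\<close> enters.\<close>

lemma log_ratio_expectation: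
  assumes "\<sigma> > 0" and f: "predictive_estimator n f"
    and int: "\<And>m. m \<in> {1..n} \<Longrightarrow> integrable (gauss_vec n \<sigma> a) (\<lambda>y. (f y m - a m)\<^sup>2)"
  shows "integrable (gauss_vec n \<sigma> a) (log_ratio n \<sigma> f a)"
    and "(\<integral>y. log_ratio n \<sigma> f a y \<partial>gauss_vec n \<sigma> a)
      = - (\<Sum>m\<in>{1..n}. \<integral>y. (f y m - a m)\<^sup>2 \<partial>gauss_vec n \<sigma> a) / (2 * \<sigma>\<^sup>2)"
proof -
  note cross = gauss_vec_cross_moment[OF \<open>\<sigma> > 0\<close> f _ int]
  let ?t = "\<lambda>m y. (2 * ((y m - a m) * (f y m - a m)) - (f y m - a m)\<^sup>2) / (2 * \<sigma>\<^sup>2)"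
  have I: "integrable (gauss_vec n \<sigma> a) (?t m)" if "m \<in> {1..n}" for m
    using cross(1)[OF that that] int[OF that]
    by (intro integrable_divide_zero integrable_diff integrable_mult_right) auto
  show "integrable (gauss_vec n \<sigma> a) (log_ratio n \<sigma> f a)"
    unfolding log_ratio_def[abs_def] using I by (rule Bochner_Integration.integrable_sum)
  have E: "(\<integral>y. ?t m y \<partial>gauss_vec n \<sigma> a) = - (\<integral>y. (f y m - a m)\<^sup>2 \<partial>gauss_vec n \<sigma> a) / (2 * \<sigma>\<^sup>2)"
    if m: "m \<in> {1..n}" for m
  proof -
    have "(\<integral>y. 2 * ((y m - a m) * (f y m - a m)) - (f y m - a m)\<^sup>2 \<partial>gauss_vec n \<sigma> a)
        = 2 * (\<integral>y. (y m - a m) * (f y m - a m) \<partial>gauss_vec n \<sigma> a) - (\<integral>y. (f y m - a m)\<^sup>2 \<partial>gauss_vec n \<sigma> a)"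
      using cross(1)[OF m m] int[OF m]
      by (subst Bochner_Integration.integral_diff) (auto simp only: integral_mult_right_zero intro: integrable_mult_right)
    then show ?thesis
      using cross(2)[OF m m] by (simp only: integral_divide_zero mult_zero_right diff_0)
  qed
  have "(\<integral>y. log_ratio n \<sigma> f a y \<partial>gauss_vec n \<sigma> a) = (\<Sum>m\<in>{1..n}. \<integral>y. ?t m y \<partial>gauss_vec n \<sigma> a)"
    unfolding log_ratio_def using I by (rule Bochner_Integration.integral_sum)
  also have "\<dots> = - (\<Sum>m\<in>{1..n}. \<integral>y. (f y m - a m)\<^sup>2 \<partial>gauss_vec n \<sigma> a) / (2 * \<sigma>\<^sup>2)"
    by (simp only: sum.cong[OF refl E] sum_divide_distrib[symmetric] sum_negf)
  finally show "(\<integral>y. log_ratio n \<sigma> f a y \<partial>gauss_vec n \<sigma> a)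
      = - (\<Sum>m\<in>{1..n}. \<integral>y. (f y m - a m)\<^sup>2 \<partial>gauss_vec n \<sigma> a) / (2 * \<sigma>\<^sup>2)" .
qed

text \<open>The variational bound for relative entropy: \<open>ln x \<le> x - 1\<close> is applied to \<open>x = g * dQ/dP\<close>,
  with \<open>g = k / 2\<close> on \<open>S\<close> and \<open>g = 1 / 2\<close> elsewhere, so that the \<open>Q\<close>-mean of \<open>g\<close> is at most 1.\<close>

lemma predictive_measure_test_bound:
  assumes "\<sigma> > 0" and f: "predictive_estimator n f"
    and int: "\<And>m. m \<in> {1..n} \<Longrightarrow> integrable (gauss_vec n \<sigma> a) (\<lambda>y. (f y m - a m)\<^sup>2)"
    and S: "S \<in> sets (Rn n)" and "k > 0"
    and Q: "measure (predictive_measure n \<sigma> f) S \<le> 1 / k"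
  shows "measure (gauss_vec n \<sigma> a) S * ln k - ln 2
    \<le> (\<Sum>m\<in>{1..n}. \<integral>y. (f y m - a m)\<^sup>2 \<partial>gauss_vec n \<sigma> a) / (2 * \<sigma>\<^sup>2)"
proof -
  interpret G: prob_space "gauss_vec n \<sigma> a" by (rule prob_space_gauss_vec) fact
  interpret Q: prob_space "predictive_measure n \<sigma> f" by (rule prob_space_predictive_measure) fact+
  let ?L = "log_ratio n \<sigma> f a"
  have est: "estimator n f" using f by (simp add: predictive_estimator_def)
  note log_ratio_measurable[OF est, measurable] S[measurable]
  define g where "g y = (if y \<in> S then k else 1) / 2" for y
  have g [measurable]: "g \<in> borel_measurable (Rn n)" unfolding g_def by measurable
  have g_pos: "g y > 0" for y using \<open>k > 0\<close> by (simp add: g_def)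
  have "(\<integral>\<^sup>+y. ennreal (exp (?L y) * g y) \<partial>gauss_vec n \<sigma> a)
      = (\<integral>\<^sup>+y. ennreal (exp (?L y)) * ennreal (g y) \<partial>gauss_vec n \<sigma> a)"
    using g_pos by (simp add: ennreal_mult' less_imp_le)
  also have "\<dots> = (\<integral>\<^sup>+y. ennreal (g y) \<partial>predictive_measure n \<sigma> f)"
    using \<open>\<sigma> > 0\<close> est by (rule nn_integral_log_ratio) measurable
  \<comment> \<open>An extra 1 / 2 is conceded on \<open>S\<close>. As the predictive measure of
    \<open>S\<close> is at most \<open>1 / k\<close>, both summands then contribute at most 1 /
    2.\<close>
  also have "\<dots> \<le> (\<integral>\<^sup>+y. ennreal (k / 2) * indicator S y + ennreal (1 / 2) \<partial>predictive_measure n \<sigma> f)"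
    using \<open>k > 0\<close> by (intro nn_integral_mono) (auto simp: g_def indicator_def)
  also have "\<dots> = ennreal (k / 2) * emeasure (predictive_measure n \<sigma> f) S + ennreal (1 / 2)"
    by (subst nn_integral_add) (simp_all add: nn_integral_cmult_indicator Q.emeasure_space_1)
  also have "\<dots> = ennreal (k / 2 * measure (predictive_measure n \<sigma> f) S + 1 / 2)"
  proof -
    have "0 \<le> k / 2" "0 \<le> k / 2 * measure (predictive_measure n \<sigma> f) S" "(0::real) \<le> 1 / 2"
      using \<open>k > 0\<close> by simp_all
    then show ?thesis by (simp only: Q.emeasure_eq_measure ennreal_plus ennreal_mult')
  qed
  also have "\<dots> \<le> 1"
  proof -
    have "k / 2 * measure (predictive_measure n \<sigma> f) S + 1 / 2 \<le> 1"
      using mult_left_mono[OF Q, of "k / 2"] \<open>k > 0\<close> by simp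
    then show ?thesis by (metis ennreal_1 ennreal_leI)
  qed
  finally have le1: "(\<integral>\<^sup>+y. ennreal (exp (?L y) * g y) \<partial>gauss_vec n \<sigma> a) \<le> 1" .
  have X: "integrable (gauss_vec n \<sigma> a) (\<lambda>y. exp (?L y) * g y)"
  proof (rule integrableI_nonneg)
    show "(\<lambda>y. exp (?L y) * g y) \<in> borel_measurable (gauss_vec n \<sigma> a)" by measurable
    show "AE y in gauss_vec n \<sigma> a. 0 \<le> exp (?L y) * g y" using g_pos by (simp add: less_imp_le)
    show "(\<integral>\<^sup>+y. ennreal (exp (?L y) * g y) \<partial>gauss_vec n \<sigma> a) < \<infinity>"
      using le1 by (rule order.strict_trans1) simp
  qed
  have EX: "(\<integral>y. exp (?L y) * g y \<partial>gauss_vec n \<sigma> a) \<le> 1"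
    using le1 nn_integral_eq_integral[OF X] g_pos by (simp add: less_imp_le)
  note L = log_ratio_expectation[OF \<open>\<sigma> > 0\<close> f int]
  have ind: "integrable (gauss_vec n \<sigma> a) (\<lambda>y. indicator S y :: real)"
  proof (rule G.integrable_const_bound[where B = 1])
    show "(\<lambda>y. indicator S y :: real) \<in> borel_measurable (gauss_vec n \<sigma> a)" by measurable
  qed simp
  have const: "(\<integral>y. c \<partial>gauss_vec n \<sigma> a) = c" for c :: real
    by (simp only: lebesgue_integral_const G.prob_space scaleR_one)
  have int_lhs: "integrable (gauss_vec n \<sigma> a) (\<lambda>y. ln k * indicator S y - ln 2 + ?L y)"
    using Bochner_Integration.integrable_add[OF Bochner_Integration.integrable_diff
        [OF integrable_mult_right[OF ind] G.integrable_const] L(1)] .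
  \<comment> \<open>The left integrand is \<open>ln (exp (?L y) * g y)\<close>; the factor 1 / 2 in
    \<open>g\<close> is the source of the term \<open>ln 2\<close>.\<close>
  have "(\<integral>y. ln k * indicator S y - ln 2 + ?L y \<partial>gauss_vec n \<sigma> a)
      \<le> (\<integral>y. exp (?L y) * g y - 1 \<partial>gauss_vec n \<sigma> a)"
  proof (rule integral_mono[OF int_lhs])
    show "integrable (gauss_vec n \<sigma> a) (\<lambda>y. exp (?L y) * g y - 1)"
      by (rule Bochner_Integration.integrable_diff[OF X G.integrable_const])
    fix y
    have "ln (g y) = ln k * indicator S y - ln 2"
      using \<open>k > 0\<close> by (simp add: g_def ln_div)
    moreover have "ln (exp (?L y) * g y) = ?L y + ln (g y)"
      using g_pos[of y] by (simp add: ln_mult)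
    moreover have "ln (exp (?L y) * g y) \<le> exp (?L y) * g y - 1"
      using g_pos[of y] by (intro ln_le_minus_one) simp
    ultimately show "ln k * indicator S y - ln 2 + ?L y \<le> exp (?L y) * g y - 1" by simp
  qed
  also have "\<dots> = (\<integral>y. exp (?L y) * g y \<partial>gauss_vec n \<sigma> a) - 1"
    unfolding Bochner_Integration.integral_diff[OF X G.integrable_const] const ..
  also have "\<dots> \<le> 0" using EX by simp
  \<comment> \<open>From here on the equations rewrite the left-hand side of the chain, until it is
    the probability of \<open>S\<close> times \<open>ln k\<close>, minus \<open>ln 2\<close>, plus
    the mean of \<open>?L\<close>.\<close>
  also have "(\<integral>y. ln k * indicator S y - ln 2 + ?L y \<partial>gauss_vec n \<sigma> a)
      = (\<integral>y. ln k * indicator S y - ln 2 \<partial>gauss_vec n \<sigma> a) + (\<integral>y. ?L y \<partial>gauss_vec n \<sigma> a)"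
    by (rule Bochner_Integration.integral_add[OF Bochner_Integration.integrable_diff
          [OF integrable_mult_right[OF ind] G.integrable_const] L(1)])
  also have "(\<integral>y. ln k * indicator S y - ln 2 \<partial>gauss_vec n \<sigma> a)
      = (\<integral>y. ln k * indicator S y \<partial>gauss_vec n \<sigma> a) - (\<integral>y. ln 2 \<partial>gauss_vec n \<sigma> a)"
    by (rule Bochner_Integration.integral_diff[OF integrable_mult_right[OF ind] G.integrable_const])
  also have "(\<integral>y. ln k * indicator S y \<partial>gauss_vec n \<sigma> a) = ln k * measure (gauss_vec n \<sigma> a) S"
  proof -
    have "S \<in> sets (gauss_vec n \<sigma> a)" using S by measurable
    then have "S \<inter> space (gauss_vec n \<sigma> a) = S" by (simp add: sets.sets_into_space inf.absorb1)
    then show ?thesis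
      by (simp only: integral_mult_right_zero Bochner_Integration.integral_indicator)
  qed
  also have "(\<integral>y. ln 2 \<partial>gauss_vec n \<sigma> a) = ln (2::real)" by (rule const)
  finally show ?thesis using L(2) by (simp add: mult.commute)
qed


section \<open>The normalized norm, and risks as Gaussian integrals\<close>

lemma nnorm_eq_L2_set: "nnorm n x = L2_set x {1..n} / sqrt (real n)"
  by (simp add: nnorm_def L2_set_def real_sqrt_mult real_sqrt_divide)

lemma nnorm_power2: "(nnorm n x)\<^sup>2 = (\<Sum>i=1..n. (x i)\<^sup>2) / real n"
  by (simp add: nnorm_def sum_nonneg)

text \<open>The orientation matches \<open>is_packing\<close> and the loss, so that a point
  \<open>x\<close> within half the separation of both \<open>a\<close> and \<open>b\<close> gives a
  contradiction.\<close>

lemma nnorm_diff_triangle: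
  "nnorm n (\<lambda>i. b i - a i) \<le> nnorm n (\<lambda>i. x i - a i) + nnorm n (\<lambda>i. x i - b i)"
proof -
  have "L2_set (\<lambda>i. b i - a i) {1..n} = L2_set (\<lambda>i. (x i - a i) + (b i - x i)) {1..n}"
    by simp
  also have "\<dots> \<le> L2_set (\<lambda>i. x i - a i) {1..n} + L2_set (\<lambda>i. b i - x i) {1..n}"
    by (rule L2_set_triangle_ineq)
  also have "L2_set (\<lambda>i. b i - x i) {1..n} = L2_set (\<lambda>i. x i - b i) {1..n}"
    by (simp add: L2_set_def power2_commute)
  finally show ?thesis
    unfolding nnorm_eq_L2_set add_divide_distrib[symmetric] by (rule divide_right_mono) simp
qed

lemma nnorm_estimator_measurable:
  assumes "estimator n f"
  shows "(\<lambda>y. nnorm n (\<lambda>i. f y i - a i)) \<in> borel_measurable (Rn n)"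
proof -
  have [measurable]: "(\<lambda>y. \<Sum>i=1..n. (f y i - a i)\<^sup>2) \<in> borel_measurable (Rn n)"
    by (intro borel_measurable_sum borel_measurable_power borel_measurable_diff
        borel_measurable_const estimator_coord_measurable[OF assms])
  show ?thesis unfolding nnorm_def by measurable
qed

text \<open>Push-forward along the sample: the risk depends on the probability space only through
  the law of the observations.\<close>

lemma risk_eq_gauss_vec:
  assumes M: "prob_space M" and "n \<ge> 1"
    and indep: "prob_space.indep_vars M (\<lambda>_. borel) Y {1..n}"
    and Y: "\<And>m. m \<in> {1..n} \<Longrightarrow> distributed M lborel (Y m) (\<lambda>x. ennreal (normal_density (a m) \<sigma> x))"
    and f: "estimator n f"
  shows "risk n M Y f a = (\<integral>\<^sup>+y. ennreal ((nnorm n (\<lambda>i. f y i - a i))\<^sup>2) \<partial>gauss_vec n \<sigma> a)"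
proof -
  have "Y m \<in> borel_measurable M" if "m \<in> {1..n}" for m
    using distributed_measurable[OF Y[OF that]] by simp
  then have s: "sample n Y \<in> M \<rightarrow>\<^sub>M Rn n" by (rule sample_measurable)
  note nnorm_estimator_measurable[OF f, measurable]
  have "(\<integral>\<^sup>+y. ennreal ((nnorm n (\<lambda>i. f y i - a i))\<^sup>2) \<partial>distr M (Rn n) (sample n Y)) = risk n M Y f a"
    unfolding risk_def by (rule nn_integral_distr[OF s]) measurable
  then show ?thesis
    using distr_sample[OF M \<open>n \<ge> 1\<close> indep Y] by simp
qed

text \<open>Passage to real integrals: a finite bound in \<open>ennreal\<close> excludes the case in
  which the Bochner integral would default to 0.\<close>

lemma nnorm_power2_integrable:
  assumes f: "estimator n f" and "0 \<le> c"
    and le: "(\<integral>\<^sup>+y. ennreal ((nnorm n (\<lambda>i. f y i - a i))\<^sup>2) \<partial>gauss_vec n \<sigma> a) \<le> ennreal c"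
  shows "integrable (gauss_vec n \<sigma> a) (\<lambda>y. (nnorm n (\<lambda>i. f y i - a i))\<^sup>2)"
    and "(\<integral>y. (nnorm n (\<lambda>i. f y i - a i))\<^sup>2 \<partial>gauss_vec n \<sigma> a) \<le> c"
proof -
  note nnorm_estimator_measurable[OF f, measurable]
  show I: "integrable (gauss_vec n \<sigma> a) (\<lambda>y. (nnorm n (\<lambda>i. f y i - a i))\<^sup>2)"
  proof (rule integrableI_nonneg)
    show "(\<integral>\<^sup>+y. ennreal ((nnorm n (\<lambda>i. f y i - a i))\<^sup>2) \<partial>gauss_vec n \<sigma> a) < \<infinity>"
      using le by (rule order.strict_trans1) simp
    show "(\<lambda>y. (nnorm n (\<lambda>i. f y i - a i))\<^sup>2) \<in> borel_measurable (gauss_vec n \<sigma> a)"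
      by measurable
  qed simp
  show "(\<integral>y. (nnorm n (\<lambda>i. f y i - a i))\<^sup>2 \<partial>gauss_vec n \<sigma> a) \<le> c"
    using le nn_integral_eq_integral[OF I] \<open>0 \<le> c\<close> by simp
qed

text \<open>Each squared coordinate error is dominated by \<open>real n\<close> times the squared
  norm. Undoing the normalization of \<open>nnorm\<close> puts the factor \<open>n\<close> in front
  of the predictive risk.\<close>

lemma sum_coord_error:
  assumes "n \<ge> 1" and f: "estimator n f"
    and I: "integrable (gauss_vec n \<sigma> a) (\<lambda>y. (nnorm n (\<lambda>i. f y i - a i))\<^sup>2)"
  shows "m \<in> {1..n} \<Longrightarrow> integrable (gauss_vec n \<sigma> a) (\<lambda>y. (f y m - a m)\<^sup>2)"
    and "(\<Sum>m\<in>{1..n}. \<integral>y. (f y m - a m)\<^sup>2 \<partial>gauss_vec n \<sigma> a)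
      = real n * (\<integral>y. (nnorm n (\<lambda>i. f y i - a i))\<^sup>2 \<partial>gauss_vec n \<sigma> a)"
proof -
  have sum_eq: "(\<Sum>i\<in>{1..n}. (f y i - a i)\<^sup>2) = real n * (nnorm n (\<lambda>i. f y i - a i))\<^sup>2" for y
    using \<open>n \<ge> 1\<close> by (simp add: nnorm_power2)
  have J: "integrable (gauss_vec n \<sigma> a) (\<lambda>y. (f y m - a m)\<^sup>2)" if m: "m \<in> {1..n}" for m
  proof (rule Bochner_Integration.integrable_bound)
    show "integrable (gauss_vec n \<sigma> a) (\<lambda>y. real n * (nnorm n (\<lambda>i. f y i - a i))\<^sup>2)"
      using I by simp
    note estimator_coord_measurable[OF f m, measurable]
    show "(\<lambda>y. (f y m - a m)\<^sup>2) \<in> borel_measurable (gauss_vec n \<sigma> a)" by measurable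
    have "(f y m - a m)\<^sup>2 \<le> real n * (nnorm n (\<lambda>i. f y i - a i))\<^sup>2" for y
      unfolding sum_eq[symmetric] using m by (intro member_le_sum) auto
    then show "AE y in gauss_vec n \<sigma> a. norm ((f y m - a m)\<^sup>2) \<le> norm (real n * (nnorm n (\<lambda>i. f y i - a i))\<^sup>2)"
      by simp
  qed
  then show "m \<in> {1..n} \<Longrightarrow> integrable (gauss_vec n \<sigma> a) (\<lambda>y. (f y m - a m)\<^sup>2)" .
  have "(\<Sum>m\<in>{1..n}. \<integral>y. (f y m - a m)\<^sup>2 \<partial>gauss_vec n \<sigma> a)
      = (\<integral>y. (\<Sum>m\<in>{1..n}. (f y m - a m)\<^sup>2) \<partial>gauss_vec n \<sigma> a)"
    using J by (rule Bochner_Integration.integral_sum[symmetric])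
  then show "(\<Sum>m\<in>{1..n}. \<integral>y. (f y m - a m)\<^sup>2 \<partial>gauss_vec n \<sigma> a)
      = real n * (\<integral>y. (nnorm n (\<lambda>i. f y i - a i))\<^sup>2 \<partial>gauss_vec n \<sigma> a)"
    by (simp only: sum_eq integral_mult_right_zero)
qed

section \<open>The bound for a finite packing\<close>

text \<open>Averaging: otherwise the disjoint union would have probability above 1.\<close>

lemma (in prob_space) exists_prob_le_inverse_card:
  assumes "finite B" "B \<noteq> {}" "S ` B \<subseteq> events" "disjoint_family_on S B"
  shows "\<exists>b\<in>B. prob (S b) \<le> 1 / real (card B)"
proof (rule ccontr)
  assume "\<not> ?thesis"
  then have "(\<Sum>b\<in>B. 1 / real (card B)) < (\<Sum>b\<in>B. prob (S b))"
    using assms(1,2) by (intro sum_strict_mono) (auto simp: not_le)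
  also have "\<dots> = prob (\<Union>b\<in>B. S b)"
    using assms(1,3,4) by (rule finite_measure_finite_Union[symmetric])
  also have "\<dots> \<le> 1" by (rule prob_le_1)
  finally show False using assms(1,2) by simp
qed

text \<open>The product form holds whatever the sign of
  \<open>1 - 4 * r / \<epsilon>\<^sup>2\<close>; the forms with quotients arise on dividing by this
  factor or by the logarithm, once it is known to be positive.\<close>

lemma finite_packing_bound:
  assumes "\<sigma> > 0" "n \<ge> 1" "\<epsilon> > 0" "finite B" "0 \<le> r" "0 \<le> rs"
    and sep: "\<And>a b. a \<in> B \<Longrightarrow> b \<in> B \<Longrightarrow> a \<noteq> b \<Longrightarrow> nnorm n (\<lambda>i. b i - a i) > \<epsilon>"
    and g: "estimator n g" and f: "predictive_estimator n f"
    and r: "\<And>a. a \<in> B \<Longrightarrow> (\<integral>\<^sup>+y. ennreal ((nnorm n (\<lambda>i. g y i - a i))\<^sup>2) \<partial>gauss_vec n \<sigma> a) \<le> ennreal r"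
    and rs: "\<And>a. a \<in> B \<Longrightarrow> (\<integral>\<^sup>+y. ennreal ((nnorm n (\<lambda>i. f y i - a i))\<^sup>2) \<partial>gauss_vec n \<sigma> a) \<le> ennreal rs"
  shows "(1 - 4 * r / \<epsilon>\<^sup>2) * ln (real (card B)) \<le> real n * rs / (2 * \<sigma>\<^sup>2) + ln 2"
proof (cases "B = {}")
  case True
  \<comment> \<open>An empty \<open>B\<close> has
    \<open>ln (real (card B)) = ln 0 = 0\<close>.\<close>
  then show ?thesis using \<open>0 \<le> rs\<close> by simp
next
  case False
  \<comment> \<open>The region in which \<open>g\<close> points to \<open>a\<close>. Because the
    separation is strict, even closed balls of radius \<open>\<epsilon> / 2\<close> do not
    meet.\<close>
  define S where "S a = {y \<in> space (Rn n). nnorm n (\<lambda>i. g y i - a i) \<le> \<epsilon> / 2}" for a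
  have fe: "estimator n f" using f by (simp add: predictive_estimator_def)
  have S: "S a \<in> sets (Rn n)" for a
    using nnorm_estimator_measurable[OF g, of a] unfolding S_def by measurable
  have disj: "disjoint_family_on S B"
    unfolding disjoint_family_on_def
  proof (intro ballI impI)
    fix a b assume ab: "a \<in> B" "b \<in> B" "a \<noteq> b"
    have "False" if "y \<in> S a" "y \<in> S b" for y
      using that sep[OF ab] nnorm_diff_triangle[of n b a "g y"] by (simp add: S_def)
    then show "S a \<inter> S b = {}" by blast
  qed
  interpret Q: prob_space "predictive_measure n \<sigma> f"
    by (rule prob_space_predictive_measure) fact+
  \<comment> \<open>The predictive measure is common to all of \<open>B\<close>, so it is small on
    the region of some member; everything below concerns this one \<open>a\<close>.\<close>
  obtain a where a: "a \<in> B"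
    and Qa: "measure (predictive_measure n \<sigma> f) (S a) \<le> 1 / real (card B)"
    using Q.exists_prob_le_inverse_card[OF \<open>finite B\<close> False _ disj] S sets_predictive_measure by blast
  interpret G: prob_space "gauss_vec n \<sigma> a" by (rule prob_space_gauss_vec) fact
  have SG: "S a \<in> sets (gauss_vec n \<sigma> a)" using S sets_gauss_vec by blast
  have card: "real (card B) \<ge> 1" using \<open>finite B\<close> False by (simp add: Suc_leI card_gt_0_iff)
  note Ig = nnorm_power2_integrable[OF g \<open>0 \<le> r\<close> r[OF a]]
  note If = nnorm_power2_integrable[OF fe \<open>0 \<le> rs\<close> rs[OF a]]
  \<comment> \<open>An error of at least \<open>\<epsilon> / 2\<close>, written with squares so that
    Markov's inequality applies directly to the risk.\<close>
  let ?T = "{y \<in> space (gauss_vec n \<sigma> a). \<epsilon>\<^sup>2 / 4 \<le> (nnorm n (\<lambda>i. g y i - a i))\<^sup>2}"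
  have "1 - measure (gauss_vec n \<sigma> a) (S a) = measure (gauss_vec n \<sigma> a) (space (gauss_vec n \<sigma> a) - S a)"
    using SG by (rule G.prob_compl[symmetric])
  also have "\<dots> \<le> measure (gauss_vec n \<sigma> a) ?T"
  proof (rule G.finite_measure_mono)
    note nnorm_estimator_measurable[OF g, measurable]
    show "?T \<in> G.events" by measurable
    show "space (gauss_vec n \<sigma> a) - S a \<subseteq> ?T"
    proof
      fix y assume y: "y \<in> space (gauss_vec n \<sigma> a) - S a"
      then have "\<epsilon> / 2 \<le> nnorm n (\<lambda>i. g y i - a i)" by (auto simp: S_def space_PiM)
      then have "(\<epsilon> / 2)\<^sup>2 \<le> (nnorm n (\<lambda>i. g y i - a i))\<^sup>2" using \<open>\<epsilon> > 0\<close> by (intro power_mono) auto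
      then show "y \<in> ?T" using y by (simp add: power_divide)
    qed
  qed
  also have "\<dots> \<le> (\<integral>y. (nnorm n (\<lambda>i. g y i - a i))\<^sup>2 \<partial>gauss_vec n \<sigma> a) / (\<epsilon>\<^sup>2 / 4)"
    using \<open>\<epsilon> > 0\<close> by (intro integral_Markov_inequality_measure[OF Ig(1) sets.empty_sets]) auto
  also have "\<dots> \<le> r / (\<epsilon>\<^sup>2 / 4)"
    using Ig(2) by (rule divide_right_mono) simp
  finally have prob: "1 - 4 * r / \<epsilon>\<^sup>2 \<le> measure (gauss_vec n \<sigma> a) (S a)"
    by (simp add: mult.commute)
  \<comment> \<open>As \<open>card B\<close> is at least 1, its logarithm is nonnegative, and the
    bound on the probability can be multiplied by it even where
    \<open>1 - 4 * r / \<epsilon>\<^sup>2\<close> is negative. The test bound is then used with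
    \<open>k = real (card B)\<close>.\<close>
  have "(1 - 4 * r / \<epsilon>\<^sup>2) * ln (real (card B)) - ln 2
      \<le> measure (gauss_vec n \<sigma> a) (S a) * ln (real (card B)) - ln 2"
    using prob card by (intro diff_right_mono mult_right_mono) auto
  also have "\<dots> \<le> (\<Sum>m\<in>{1..n}. \<integral>y. (f y m - a m)\<^sup>2 \<partial>gauss_vec n \<sigma> a) / (2 * \<sigma>\<^sup>2)"
    using card sum_coord_error(1)[OF \<open>n \<ge> 1\<close> fe If(1)] S Qa
    by (intro predictive_measure_test_bound \<open>\<sigma> > 0\<close> f) auto
  also have "\<dots> \<le> real n * rs / (2 * \<sigma>\<^sup>2)"
    unfolding sum_coord_error(2)[OF \<open>n \<ge> 1\<close> fe If(1)]
    using If(2) by (intro divide_right_mono mult_left_mono) auto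
  finally show ?thesis by simp
qed

section \<open>Packing numbers and their logarithms\<close>

text \<open>The supremum in \<open>enat\<close> of a nonempty set is its maximum if the set is
  finite and \<infinity> otherwise, so a finite value is attained. The empty packing ensures
  nonemptiness.\<close>

lemma packing_number_enatE:
  assumes "packing_number n \<epsilon> A = enat k"
  obtains B where "finite B" "is_packing n \<epsilon> A B" "card B = k"
proof -
  let ?X = "{enat (card B) | B. finite B \<and> is_packing n \<epsilon> A B}"
  have "is_packing n \<epsilon> A {}" by (simp add: is_packing_def)
  then have ne: "?X \<noteq> {}" by blast
  have fin: "finite ?X"
    using assms ne unfolding packing_number_def Sup_enat_def by (auto split: if_splits)
  have "Sup ?X = Max ?X"
    using fin ne by (simp only: Sup_enat_def if_False if_True)
  then have "Sup ?X \<in> ?X" using Max_in[OF fin ne] by (rule ssubst)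
  then show thesis using assms that unfolding packing_number_def by auto
qed

lemma packing_number_infinityE:
  assumes "packing_number n \<epsilon> A = \<infinity>"
  obtains B where "finite B" "is_packing n \<epsilon> A B" "card B > k"
proof -
  let ?X = "{enat (card B) | B. finite B \<and> is_packing n \<epsilon> A B}"
  have "enat k < Sup ?X" using assms by (simp add: packing_number_def)
  then show thesis using that unfolding less_Sup_iff by auto
qed

text \<open>A finite packing number is attained by a packing. An infinite one is impossible, as
  packings with more than \<open>exp c\<close> members would break the bound.\<close>

lemma ln_packing_number_le:
  assumes bound: "\<And>B. finite B \<Longrightarrow> is_packing n \<epsilon> A B \<Longrightarrow> ln (real (card B)) \<le> c"
  shows "ln_enat (packing_number n \<epsilon> A) \<le> ereal c"
proof (cases "packing_number n \<epsilon> A")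
  case (enat k)
  then show ?thesis using bound by (auto elim: packing_number_enatE)
next
  case infinity
  obtain K :: nat where K: "exp c < real K" using reals_Archimedean2 by blast
  obtain B where B: "finite B" "is_packing n \<epsilon> A B" "card B > K"
    using infinity by (rule packing_number_infinityE)
  have "exp c < real (card B)" using K B(3) by linarith
  then have "c < ln (real (card B))" by (metis exp_gt_zero ln_exp ln_less_cancel_iff order.strict_trans)
  then show ?thesis using bound[OF B(1,2)] by simp
qed

text \<open>Nonnegativity of \<open>c\<close> comes from that of \<open>x\<close>, and lets the
  comparison pass to \<open>ennreal c\<close>, where negative reals are truncated to 0.\<close>

lemma enn2ereal_le_ereal:
  assumes "enn2ereal x \<le> ereal c"
  shows "0 \<le> c" "x \<le> ennreal c"
proof -
  have "0 \<le> ereal c" using enn2ereal_nonneg assms by (rule order.trans)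
  then show "0 \<le> c" by simp
  then show "x \<le> ennreal c" using assms by (simp add: less_eq_ennreal.rep_eq enn2ereal_ennreal)
qed

section \<open>The three inequalities for the packing number\<close>

theorem lemma2:
  fixes n :: nat and \<sigma> :: real and A :: "(nat \<Rightarrow> real) set"
    and P :: "(nat \<Rightarrow> real) \<Rightarrow> 'w measure" and Y :: "nat \<Rightarrow> 'w \<Rightarrow> real"
    and ahat astar :: "(nat \<Rightarrow> real) \<Rightarrow> (nat \<Rightarrow> real)"
    and r rs :: real
  assumes "n \<ge> 1" and "\<sigma> > 0"
    and "A \<subseteq> space (Rn n)" and "A \<noteq> {}"
    and "\<And>a. a \<in> A \<Longrightarrow> prob_space (P a)"
    and "\<And>a. a \<in> A \<Longrightarrow> prob_space.indep_vars (P a) (\<lambda>_. borel) Y {1..n}"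
    and "\<And>a m. a \<in> A \<Longrightarrow> m \<in> {1..n} \<Longrightarrow>
           distributed (P a) lborel (Y m) (\<lambda>x. ennreal (normal_density (a m) \<sigma> x))"
    and "estimator n ahat"
    and "\<And>a. a \<in> A \<Longrightarrow> enn2ereal (risk n (P a) Y ahat a) \<le> ereal r"
    and "predictive_estimator n astar"
    and "\<And>a. a \<in> A \<Longrightarrow> enn2ereal (risk n (P a) Y astar a) \<le> ereal rs"
  shows "(\<forall>\<epsilon>>0. packing_number n \<epsilon> A \<ge> 2 \<longrightarrow>
            ereal r \<ge> ereal (\<epsilon>\<^sup>2 / 4) *
              (1 - ereal (real n * rs / (2 * \<sigma>\<^sup>2) + ln 2) / ln_enat (packing_number n \<epsilon> A)))
       \<and> (\<forall>\<epsilon>>0. \<epsilon>\<^sup>2 > 4 * r \<longrightarrow>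
            ln_enat (packing_number n \<epsilon> A)
              \<le> ereal ((real n * rs / (2 * \<sigma>\<^sup>2) + ln 2) / (1 - 4 * r / \<epsilon>\<^sup>2)))
       \<and> (\<forall>\<epsilon>>0. \<epsilon>\<^sup>2 \<ge> 8 * r \<longrightarrow>
            ln_enat (packing_number n \<epsilon> A) \<le> ereal (real n * rs / \<sigma>\<^sup>2 + 2 * ln 2))"
proof -
  note n = assms(1) and \<sigma> = assms(2)
  \<comment> \<open>A single point of \<open>A\<close> supplies risks below \<open>r\<close> and
    \<open>rs\<close>, which makes both bounds nonnegative.\<close>
  obtain a0 where a0: "a0 \<in> A" using \<open>A \<noteq> {}\<close> by blast
  have fe: "estimator n astar" using assms(10) by (simp add: predictive_estimator_def)
  note r = enn2ereal_le_ereal[OF assms(9)] and rs = enn2ereal_le_ereal[OF assms(11)]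
  have risk: "risk n (P a) Y h a = (\<integral>\<^sup>+y. ennreal ((nnorm n (\<lambda>i. h y i - a i))\<^sup>2) \<partial>gauss_vec n \<sigma> a)"
    if "a \<in> A" "estimator n h" for a h
    using assms(5)[OF that(1)] n assms(6)[OF that(1)] assms(7)[OF that(1)] that(2)
    by (rule risk_eq_gauss_vec)
  define C where "C = real n * rs / (2 * \<sigma>\<^sup>2) + ln 2"
  have rs0: "0 \<le> rs" using rs(1)[OF a0] .
  have r0: "0 \<le> r" using r(1)[OF a0] .
  have C0: "0 \<le> C" using rs0 by (simp add: C_def)
  have core: "(1 - 4 * r / \<epsilon>\<^sup>2) * ln (real (card B)) \<le> C"
    if "\<epsilon> > 0" "finite B" "is_packing n \<epsilon> A B" for \<epsilon> B
    unfolding C_def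
  proof (rule finite_packing_bound[OF \<sigma> n that(1,2) r0 rs0 _ assms(8,10)])
    fix a assume "a \<in> B"
    then have a: "a \<in> A" using that(3) by (auto simp: is_packing_def)
    show "(\<integral>\<^sup>+y. ennreal ((nnorm n (\<lambda>i. ahat y i - a i))\<^sup>2) \<partial>gauss_vec n \<sigma> a) \<le> ennreal r"
      using r(2)[OF a] risk[OF a assms(8)] by simp
    show "(\<integral>\<^sup>+y. ennreal ((nnorm n (\<lambda>i. astar y i - a i))\<^sup>2) \<partial>gauss_vec n \<sigma> a) \<le> ennreal rs"
      using rs(2)[OF a] risk[OF a fe] by simp
  qed (use that(3) in \<open>auto simp: is_packing_def\<close>)
  have part2: "ln_enat (packing_number n \<epsilon> A) \<le> ereal (C / (1 - 4 * r / \<epsilon>\<^sup>2))"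
    if "\<epsilon> > 0" "\<epsilon>\<^sup>2 > 4 * r" for \<epsilon>
  proof (rule ln_packing_number_le)
    have "1 - 4 * r / \<epsilon>\<^sup>2 > 0" using that by simp
    then show "ln (real (card B)) \<le> C / (1 - 4 * r / \<epsilon>\<^sup>2)" if "finite B" "is_packing n \<epsilon> A B" for B
      using core[OF \<open>\<epsilon> > 0\<close> that] by (simp add: pos_le_divide_eq mult.commute)
  qed
  have part3: "ln_enat (packing_number n \<epsilon> A) \<le> ereal (real n * rs / \<sigma>\<^sup>2 + 2 * ln 2)"
    if "\<epsilon> > 0" "\<epsilon>\<^sup>2 \<ge> 8 * r" for \<epsilon>
  proof -
    have "\<epsilon>\<^sup>2 > 0" using \<open>\<epsilon> > 0\<close> by simp
    then have gt: "\<epsilon>\<^sup>2 > 4 * r" using that(2) r0 by linarith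
    \<comment> \<open>A denominator of at least 1 / 2 at most doubles \<open>C\<close>, which turns
      \<open>2 * \<sigma>\<^sup>2\<close> into \<open>\<sigma>\<^sup>2\<close> and
      \<open>ln 2\<close> into \<open>2 * ln 2\<close>.\<close>
    have "1 / 2 \<le> 1 - 4 * r / \<epsilon>\<^sup>2" using that(2) \<open>\<epsilon>\<^sup>2 > 0\<close> by (simp add: field_simps)
    then have "C / (1 - 4 * r / \<epsilon>\<^sup>2) \<le> C / (1 / 2)"
      using C0 by (intro divide_left_mono) auto
    also have "\<dots> = real n * rs / \<sigma>\<^sup>2 + 2 * ln 2" by (simp add: C_def field_simps)
    finally show ?thesis using part2[OF \<open>\<epsilon> > 0\<close> gt] by (meson ereal_less_eq(3) order.trans)
  qed
  have part1: "ereal r \<ge> ereal (\<epsilon>\<^sup>2 / 4) * (1 - ereal C / ln_enat (packing_number n \<epsilon> A))"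
    if "\<epsilon> > 0" "packing_number n \<epsilon> A \<ge> 2" for \<epsilon>
  proof (cases "packing_number n \<epsilon> A")
    case (enat k)
    then obtain B where B: "finite B" "is_packing n \<epsilon> A B" "card B = k"
      by (rule packing_number_enatE)
    have "k \<ge> 2" using that(2) enat by (simp add: numeral_eq_enat)
    then have lnk: "ln (real k) > 0" by simp
    have "\<epsilon>\<^sup>2 > 0" using \<open>\<epsilon> > 0\<close> by simp
    \<comment> \<open>Dividing \<open>core\<close> by the logarithm, positive as
      \<open>k \<ge> 2\<close>, is valid for either sign of the left-hand side.\<close>
    have "1 - 4 * r / \<epsilon>\<^sup>2 \<le> C / ln (real k)"
      using core[OF \<open>\<epsilon> > 0\<close> B(1,2)] lnk B(3) by (simp add: pos_le_divide_eq)
    then have "\<epsilon>\<^sup>2 / 4 * (1 - C / ln (real k)) \<le> \<epsilon>\<^sup>2 / 4 * (4 * r / \<epsilon>\<^sup>2)"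
      by (intro mult_left_mono) auto
    also have "\<dots> = r" using \<open>\<epsilon>\<^sup>2 > 0\<close> by simp
    finally show ?thesis using lnk enat by (simp add: one_ereal_def)
  next
    case infinity
    \<comment> \<open>If \<open>4 * r < \<epsilon>\<^sup>2\<close>, the second inequality would
      bound an infinite logarithm by a real. In \<open>ereal\<close>,
      \<open>C / \<infinity> = 0\<close>, so the claim has become
      \<open>\<epsilon>\<^sup>2 / 4 \<le> r\<close>.\<close>
    have "\<not> \<epsilon>\<^sup>2 > 4 * r" using part2[OF \<open>\<epsilon> > 0\<close>] infinity by auto
    then show ?thesis using infinity by simp
  qed
  show ?thesis using part1 part2 part3 unfolding C_def by blast
qed

end
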